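(* Let $n \ge 2$ and $m \ge 1$ be integers, let $S_1, S_2, \ldots, S_m \subseteq \mathbb{Z}^n$ be integrally convex sets, and let $W = S_1 + S_2 + \cdots + S_m$ be their Minkowski sum. Put $\alpha(n,m) = \left(1 - \frac{1}{n}\right)\min(n,m)$. Then for every $x \in \overline{W}$ there exists $z \in W$ with $\|x - z\|_\infty \le \alpha(n,m)$. If moreover $x \in \overline{W} \cap \mathbb{Z}^n$, then $z$ can be chosen with $\|x - z\|_\infty \le \lfloor \alpha(n,m) \rfloor = \min(n,m) - 1$.
   Context: For $S \subseteq \mathbb{R}^n$, $\overline{S}$ denotes the convex hull of $S$. The Minkowski sum is $S_1 + \cdots + S_m = \{x^1 + \cdots + x^m \mid x^i \in S_i\}$. For $x \in \mathbb{R}^n$, the integral neighborhood is $\mathrm{N}(x) = \{z \in \mathbb{Z}^n \mid |x_i - z_i| < 1 \ (i = 1, \ldots, n)\}$, i.e. the integer points $z$ with $\lfloor x_i \rfloor \le z_i \le \lceil x_i \rceil$ for all $i$. A nonempty set $S \subseteq \mathbb{Z}^n$ is integrally convex if every $x \in \overline{S}$ satisfies $x \in \overline{S \cap \mathrm{N}(x)}$. *)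

theory Defs
  imports "HOL-Analysis.Analysis" "HOL-Library.Set_Algebras"
begin

(* Subsets of Z^n are taken inside real ^ 'n with n = CARD('n). Minkowski sums are the
   pointwise sums of sets from Set_Algebras; the maximum norm is infnorm. *)

definition int_lattice :: "(real ^ 'n) set" where
  "int_lattice = {z. \<forall>i. z $ i \<in> \<int>}"

definition int_nbhd :: "real ^ 'n \<Rightarrow> (real ^ 'n) set" where
  "int_nbhd x = {z \<in> int_lattice. \<forall>i. \<bar>x $ i - z $ i\<bar> < 1}"

definition integrally_convex :: "(real ^ 'n) set \<Rightarrow> bool" where
  "integrally_convex S \<longleftrightarrow>
     S \<noteq> {} \<and> S \<subseteq> int_lattice \<and>
     (\<forall>x \<in> convex hull S. x \<in> convex hull (S \<inter> int_nbhd x))"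

definition alpha :: "nat \<Rightarrow> nat \<Rightarrow> real" where
  "alpha n m = (1 - 1 / real n) * real (min n m)"

end

theory Submission
  imports Defs
begin

text \<open>
  By the Shapley--Folkman lemma \<open>x\<close> is a sum of points \<open>y i\<close> of the convex hulls of the \<open>S i\<close>, of
  which at most \<open>n\<close> lie outside \<open>S i\<close>; so at most \<open>min n m\<close> summands need rounding. Each of these
  can be rounded to a point of \<open>S i\<close> with error at most \<open>1 - 1/n\<close> by a union bound: write \<open>y i\<close> as
  a convex combination of integral neighbours. In each coordinate the neighbours at distance more
  than \<open>1 - 1/n\<close> carry total weight less than \<open>1/n\<close>, so the neighbours that are bad in some
  coordinate carry total weight less than 1. For integral \<open>x\<close> the error is an integer.
\<close>

section \<open>The Shapley--Folkman lemma\<close>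

text \<open>Stated for an indexed family, so that vectors may repeat. An injective family has a
  dependent image; a repetition \<open>d i = d k\<close> gives a relation with coefficients 1 and
  -1.\<close>

lemma linear_relation_biggerset:
  fixes d :: "'i \<Rightarrow> 'a::euclidean_space"
  assumes "finite J" "card J > DIM('a)"
  obtains c where "(\<Sum>j\<in>J. c j *\<^sub>R d j) = 0" "\<exists>j\<in>J. c j \<noteq> 0"
proof (cases "inj_on d J")
  case True
  then have "card (d ` J) > DIM('a)" "finite (d ` J)"
    using assms by (simp_all add: card_image)
  then have "dependent (d ` J)"
    by (intro dependent_biggerset)
  then obtain c where c: "(\<Sum>v\<in>d ` J. c v *\<^sub>R v) = 0" "\<exists>v\<in>d ` J. c v \<noteq> 0"
    using \<open>finite (d ` J)\<close> by (auto simp: dependent_finite)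
  show ?thesis
  proof (rule that)
    show "(\<Sum>j\<in>J. c (d j) *\<^sub>R d j) = 0"
      using c(1) True by (simp add: sum.reindex)
    show "\<exists>j\<in>J. c (d j) \<noteq> 0"
      using c(2) by auto
  qed
next
  case False
  then obtain i k where ik: "i \<in> J" "k \<in> J" "i \<noteq> k" "d i = d k"
    by (auto simp: inj_on_def)
  let ?c = "\<lambda>j. of_bool (j = i) - of_bool (j = k) :: real"
  show ?thesis
  proof (rule that)
    have "(\<Sum>j\<in>J. ?c j *\<^sub>R d j) = (\<Sum>j\<in>J. if j = i then d j else 0) - (\<Sum>j\<in>J. if j = k then d j else 0)"
      unfolding sum_subtractf[symmetric] by (intro sum.cong) auto
    also have "\<dots> = 0"
      using ik assms(1) by simp
    finally show "(\<Sum>j\<in>J. ?c j *\<^sub>R d j) = 0" .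
    show "\<exists>j\<in>J. ?c j \<noteq> 0"
      using ik by (intro bexI[of _ i]) auto
  qed
qed

text \<open>Ratio test: move from \<open>w\<close> along \<open>u\<close> until the first decreasing
  entry reaches zero. As \<open>u\<close> vanishes wherever \<open>w\<close> does, no new nonzero
  entry appears, so the support strictly shrinks.\<close>

lemma nonneg_perturbation_smaller_support:
  fixes w u :: "'b \<Rightarrow> real"
  assumes "finite A" and w: "\<And>a. a \<in> A \<Longrightarrow> 0 \<le> w a"
    and supp: "\<And>a. a \<in> A \<Longrightarrow> w a = 0 \<Longrightarrow> u a = 0"
    and neg: "\<exists>a\<in>A. u a < 0"
  obtains t where "\<And>a. a \<in> A \<Longrightarrow> 0 \<le> w a + t * u a"
    and "card {a \<in> A. w a + t * u a \<noteq> 0} < card {a \<in> A. w a \<noteq> 0}"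
proof -
  define N where "N = {a \<in> A. u a < 0}"
  have N: "finite N" "N \<noteq> {}"
    using assms by (auto simp: N_def)
  define t where "t = Min ((\<lambda>a. w a / - u a) ` N)"
  have "t \<in> (\<lambda>a. w a / - u a) ` N"
    unfolding t_def using N by (intro Min_in) auto
  then obtain b where b: "b \<in> A" "u b < 0" "t = w b / - u b"
    by (auto simp: N_def)
  have t_le: "t \<le> w a / - u a" if "a \<in> N" for a
    unfolding t_def using N that by (intro Min_le) auto
  have "t \<ge> 0"
    using b w[OF b(1)] by (simp add: divide_nonneg_neg)
  show ?thesis
  proof (rule that[of t])
    fix a assume a: "a \<in> A"
    show "0 \<le> w a + t * u a"
    proof (cases "u a < 0")
      case True
      then have "t * - u a \<le> w a"
        using t_le[of a] a pos_le_divide_eq[of "- u a" t "w a"] by (simp add: N_def)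
      then show ?thesis by simp
    next
      case False
      then show ?thesis
        using w[OF a] \<open>t \<ge> 0\<close> by simp
    qed
  next
    have "w b + t * u b = 0" "w b \<noteq> 0"
      using b supp[of b] by auto
    then have "b \<in> {a \<in> A. w a \<noteq> 0} - {a \<in> A. w a + t * u a \<noteq> 0}"
      using b(1) by simp
    moreover have "{a \<in> A. w a + t * u a \<noteq> 0} \<subseteq> {a \<in> A. w a \<noteq> 0}"
      using supp by auto
    ultimately have "{a \<in> A. w a + t * u a \<noteq> 0} \<subset> {a \<in> A. w a \<noteq> 0}"
      by blast
    then show "card {a \<in> A. w a + t * u a \<noteq> 0} < card {a \<in> A. w a \<noteq> 0}"
      using \<open>finite A\<close> by (intro psubset_card_mono) auto
  qed
qed

text \<open>Among all weightings representing \<open>x\<close>, one with the fewest nonzero weights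
  works. Every \<open>y i\<close> outside \<open>S i\<close> needs two nonzero weights; with more
  than \<open>DIM('a)\<close> such indices, a linear relation between differences of these points
  would allow a weight to be removed.\<close>

theorem shapley_folkman:
  fixes S :: "'i \<Rightarrow> 'a::euclidean_space set"
  assumes I: "finite I" and x: "x \<in> convex hull (\<Sum>i\<in>I. S i)"
  obtains y where "\<And>i. i \<in> I \<Longrightarrow> y i \<in> convex hull (S i)"
    and "x = (\<Sum>i\<in>I. y i)"
    and "card {i \<in> I. y i \<notin> S i} \<le> DIM('a)"
proof -
  have "x \<in> {sum p I |p. \<forall>i\<in>I. p i \<in> convex hull (S i)}"
    using x unfolding convex_hull_set_sum set_sum_alt[OF I, of "\<lambda>i. convex hull (S i)"] .
  then obtain p where xp: "x = (\<Sum>i\<in>I. p i)" and p: "\<forall>i\<in>I. p i \<in> convex hull (S i)"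
    by (elim CollectE exE conjE) (rule that)
  define Q where "Q i T v \<longleftrightarrow> finite T \<and> T \<subseteq> S i \<and> (\<forall>s\<in>T. 0 \<le> v s) \<and> sum v T = 1
    \<and> (\<Sum>s\<in>T. v s *\<^sub>R s) = p i" for i T v
  have "\<forall>i\<in>I. \<exists>T v. Q i T v"
    using p by (simp only: convex_hull_explicit mem_Collect_eq Q_def)
  then obtain G v where "\<And>i. i \<in> I \<Longrightarrow> Q i (G i) (v i)"
    by metis
  then have G: "\<And>i. i \<in> I \<Longrightarrow> finite (G i)" "\<And>i. i \<in> I \<Longrightarrow> G i \<subseteq> S i"
    and v: "\<And>i s. i \<in> I \<Longrightarrow> s \<in> G i \<Longrightarrow> 0 \<le> v i s" "\<And>i. i \<in> I \<Longrightarrow> sum (v i) (G i) = 1"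
      "\<And>i. i \<in> I \<Longrightarrow> (\<Sum>s\<in>G i. v i s *\<^sub>R s) = p i"
    by (auto simp: Q_def)
  \<comment> \<open>The point sets \<open>G i\<close> stay fixed and only the weights vary. The
    total \<open>x\<close> is prescribed, while the individual summands may move away from
    \<open>p i\<close>.\<close>
  define P where "P = (\<lambda>w :: 'i \<Rightarrow> 'a \<Rightarrow> real. (\<forall>i\<in>I. (\<forall>s\<in>G i. 0 \<le> w i s) \<and> sum (w i) (G i) = 1)
    \<and> (\<Sum>i\<in>I. \<Sum>s\<in>G i. w i s *\<^sub>R s) = x)"
  define A where "A = Sigma I G"
  define N where "N = (\<lambda>w :: 'i \<Rightarrow> 'a \<Rightarrow> real. card {a \<in> A. w (fst a) (snd a) \<noteq> 0})"
  have "finite A"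
    unfolding A_def using I G by auto
  have "P v"
    using v by (auto simp: P_def xp)
  then obtain w where "P w" and least: "\<And>w'. P w' \<Longrightarrow> N w \<le> N w'"
    using ex_has_least_nat[of P v N] by auto
  then have w: "\<And>i s. i \<in> I \<Longrightarrow> s \<in> G i \<Longrightarrow> 0 \<le> w i s" "\<And>i. i \<in> I \<Longrightarrow> sum (w i) (G i) = 1"
      "(\<Sum>i\<in>I. \<Sum>s\<in>G i. w i s *\<^sub>R s) = x"
    by (auto simp: P_def)
  define y where "y i = (\<Sum>s\<in>G i. w i s *\<^sub>R s)" for i
  define J where "J = {i \<in> I. y i \<notin> S i}"
  \<comment> \<open>A single nonzero weight would have to be 1, making \<open>y i\<close> a point of
    \<open>G i\<close> and hence of \<open>S i\<close>.\<close>
  have two: "\<exists>a b. a \<in> G i \<and> b \<in> G i \<and> a \<noteq> b \<and> w i a \<noteq> 0 \<and> w i b \<noteq> 0" if "i \<in> J" for i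
  proof (rule ccontr)
    assume nt: "\<not> ?thesis"
    have i: "i \<in> I" "y i \<notin> S i" using that by (auto simp: J_def)
    then obtain a where a: "a \<in> G i" "w i a \<noteq> 0"
      using w(2)[of i] by (metis sum.neutral zero_neq_one)
    have z: "w i s = 0" if "s \<in> G i - {a}" for s
      using nt a that by blast
    have "w i a = 1"
      using w(2)[OF i(1)] sum.remove[OF G(1)[OF i(1)] a(1), of "w i"] z by simp
    moreover have "y i = w i a *\<^sub>R a"
      using sum.remove[OF G(1)[OF i(1)] a(1), of "\<lambda>s. w i s *\<^sub>R s"] z by (simp add: y_def)
    ultimately show False
      using i a G(2) by auto
  qed
  then obtain a b where ab: "\<And>i. i \<in> J \<Longrightarrow> a i \<in> G i" "\<And>i. i \<in> J \<Longrightarrow> b i \<in> G i"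
    "\<And>i. i \<in> J \<Longrightarrow> a i \<noteq> b i" "\<And>i. i \<in> J \<Longrightarrow> w i (a i) \<noteq> 0" "\<And>i. i \<in> J \<Longrightarrow> w i (b i) \<noteq> 0"
    by metis
  have J: "finite J" "J \<subseteq> I" using I by (auto simp: J_def)
  have "card J \<le> DIM('a)"
  proof (rule ccontr)
    assume "\<not> ?thesis"
    then obtain c where c: "(\<Sum>i\<in>J. c i *\<^sub>R (a i - b i)) = 0" "\<exists>i\<in>J. c i \<noteq> 0"
      using linear_relation_biggerset[OF J(1), of "\<lambda>i. a i - b i"] by force
    \<comment> \<open>Shifting weight from \<open>b i\<close> to \<open>a i\<close> in proportion to \<open>c i\<close> keeps all constraints.\<close>
    define u where "u i s = (if i \<in> J then c i * (of_bool (s = a i) - of_bool (s = b i)) else 0)" for i s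
    have u_sum: "sum (u i) (G i) = 0" if "i \<in> I" for i
    proof (cases "i \<in> J")
      case True
      then show ?thesis
        using ab G(1)[OF that]
        by (simp add: u_def sum_distrib_left[symmetric] sum_subtractf)
    qed (simp add: u_def)
    have u_scale: "(\<Sum>s\<in>G i. u i s *\<^sub>R s) = (if i \<in> J then c i *\<^sub>R (a i - b i) else 0)" if "i \<in> I" for i
    proof (cases "i \<in> J")
      case True
      have "(\<Sum>s\<in>G i. u i s *\<^sub>R s) = (\<Sum>s\<in>G i. (if s = a i then c i *\<^sub>R s else 0) - (if s = b i then c i *\<^sub>R s else 0))"
        using True by (intro sum.cong) (auto simp: u_def)
      then show ?thesis
        using True ab G(1)[OF that] by (simp add: sum_subtractf scaleR_diff_right)
    qed (simp add: u_def)
    have u_total: "(\<Sum>i\<in>I. \<Sum>s\<in>G i. u i s *\<^sub>R s) = 0"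
    proof -
      have "(\<Sum>i\<in>I. \<Sum>s\<in>G i. u i s *\<^sub>R s) = (\<Sum>i\<in>I. if i \<in> J then c i *\<^sub>R (a i - b i) else 0)"
        using u_scale by (intro sum.cong) auto
      also have "\<dots> = (\<Sum>i\<in>J. c i *\<^sub>R (a i - b i))"
        using I J by (simp add: sum.inter_restrict[symmetric] Int_absorb1)
      finally show ?thesis using c by simp
    qed
    \<comment> \<open>The entries of \<open>u i\<close> at \<open>a i\<close> and \<open>b i\<close>
      are \<open>c i\<close> and \<open>- c i\<close>, so one of them is negative whatever the sign
      of \<open>c i\<close>.\<close>
    have neg: "\<exists>z\<in>A. u (fst z) (snd z) < 0"
    proof -
      obtain i where i: "i \<in> J" "c i \<noteq> 0" using c by auto
      then have "(i, a i) \<in> A" "(i, b i) \<in> A"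
        using ab J by (auto simp: A_def)
      moreover have "u i (a i) = c i" "u i (b i) = - c i"
        using i ab(3)[of i] by (auto simp: u_def)
      ultimately show ?thesis
        using i(2) by (cases "c i < 0") force+
    qed
    obtain t where t: "\<And>z. z \<in> A \<Longrightarrow> 0 \<le> w (fst z) (snd z) + t * u (fst z) (snd z)"
      "card {z \<in> A. w (fst z) (snd z) + t * u (fst z) (snd z) \<noteq> 0} < card {z \<in> A. w (fst z) (snd z) \<noteq> 0}"
    proof (rule nonneg_perturbation_smaller_support[of A "\<lambda>z. w (fst z) (snd z)" "\<lambda>z. u (fst z) (snd z)"])
      show "0 \<le> w (fst z) (snd z)" if "z \<in> A" for z
        using that w by (auto simp: A_def)
      show "u (fst z) (snd z) = 0" if "z \<in> A" "w (fst z) (snd z) = 0" for z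
        using that ab by (auto simp: A_def u_def)
    qed (use \<open>finite A\<close> neg in auto)
    let ?w = "\<lambda>i s. w i s + t * u i s"
    have "P ?w"
      unfolding P_def
    proof (intro conjI ballI)
      show "0 \<le> ?w i s" if "i \<in> I" "s \<in> G i" for i s
        using t(1)[of "(i, s)"] that by (simp add: A_def)
      show "sum (?w i) (G i) = 1" if "i \<in> I" for i
        using w(2)[OF that] u_sum[OF that] by (simp add: sum.distrib sum_distrib_left[symmetric])
      have "(\<Sum>i\<in>I. \<Sum>s\<in>G i. ?w i s *\<^sub>R s)
          = (\<Sum>i\<in>I. \<Sum>s\<in>G i. w i s *\<^sub>R s) + t *\<^sub>R (\<Sum>i\<in>I. \<Sum>s\<in>G i. u i s *\<^sub>R s)"
        by (simp add: scaleR_add_left sum.distrib scaleR_sum_right)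
      then show "(\<Sum>i\<in>I. \<Sum>s\<in>G i. ?w i s *\<^sub>R s) = x"
        using w(3) u_total by simp
    qed
    then show False
      using least[of ?w] t(2) by (simp add: N_def)
  qed
  then show ?thesis
  proof (intro that[of y])
    show "y i \<in> convex hull (S i)" if "i \<in> I" for i
      unfolding convex_hull_explicit mem_Collect_eq y_def
      using that w(1,2) G by (intro exI[of _ "G i"] exI[of _ "w i"]) auto
  qed (use w in \<open>auto simp: y_def J_def\<close>)
qed

section \<open>Rounding within one integrally convex set\<close>

text \<open>As \<open>r\<close> is at least 1/2, all far values coincide with one integer
  \<open>p q\<close>. Averaging the deviation from \<open>p q\<close> in the direction of
  \<open>t\<close>, far points contribute nothing and each other point at most its weight. So the
  weight of the other points is at least the distance from \<open>t\<close> to \<open>p q\<close>,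
  which exceeds \<open>r\<close>.\<close>

lemma weight_of_far_integers:
  fixes p u :: "'b \<Rightarrow> real" and t r :: real
  assumes "finite T" and u: "\<And>z. z \<in> T \<Longrightarrow> 0 \<le> u z" "sum u T = 1"
    and t: "(\<Sum>z\<in>T. u z * p z) = t"
    and p: "\<And>z. z \<in> T \<Longrightarrow> p z \<in> \<int>" "\<And>z. z \<in> T \<Longrightarrow> \<bar>t - p z\<bar> < 1"
    and r: "1/2 \<le> r" "r < 1"
  shows "sum u {z \<in> T. r < \<bar>t - p z\<bar>} < 1 - r"
proof (cases "{z \<in> T. r < \<bar>t - p z\<bar>} = {}")
  case True
  then show ?thesis using r by (simp only: True sum.empty)
next
  case False
  define B where "B = {z \<in> T. r < \<bar>t - p z\<bar>}"
  obtain q where q: "q \<in> T" "r < \<bar>t - p q\<bar>" using False by blast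
  \<comment> \<open>The sign orients the axis from \<open>p q\<close> towards \<open>t\<close>,
    which treats rounding down and rounding up together.\<close>
  define s where "s = sgn (t - p q)"
  have pt: "s * (p z - p q) \<le> of_bool (z \<notin> B)" if z: "z \<in> T" for z
  proof -
    obtain k l where kl: "p z = of_int k" "p q = of_int l"
      using p(1) z q(1) by (metis Ints_cases)
    have *: "\<bar>t - of_int k\<bar> < 1" "\<bar>t - of_int l\<bar> < 1" "r < \<bar>t - of_int l\<bar>"
      using p(2)[OF z] p(2)[OF q(1)] q(2) kl by auto
    show ?thesis
    proof (cases "t > of_int l")
      case True
      have "k \<le> l + 1" using * True by linarith
      \<comment> \<open>Here \<open>t\<close> lies strictly between \<open>l\<close> and
        \<open>l + 1\<close>, and its distances to them add up to 1, so they cannot both exceed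
        \<open>r\<close>.\<close>
      moreover have "k \<noteq> l + 1" if "z \<in> B"
        using that * True r kl by (auto simp: B_def)
      ultimately show ?thesis
        using True kl by (cases "z \<in> B") (auto simp: s_def)
    next
      case False
      then have lt: "t < of_int l" using * r by linarith
      have "l \<le> k + 1" using * lt by linarith
      moreover have "l \<noteq> k + 1" if "z \<in> B"
        using that * lt r kl by (auto simp: B_def)
      ultimately show ?thesis
        using lt kl by (cases "z \<in> B") (auto simp: s_def)
    qed
  qed
  have "\<bar>t - p q\<bar> = s * (t - p q)"
    by (simp add: s_def abs_sgn mult.commute)
  also have "\<dots> = s * ((\<Sum>z\<in>T. u z * p z) - (\<Sum>z\<in>T. u z) * p q)"
    using t u by simp
  also have "\<dots> = (\<Sum>z\<in>T. u z * (s * (p z - p q)))"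
    by (simp add: sum_distrib_left sum_distrib_right sum_subtractf algebra_simps)
  also have "\<dots> \<le> (\<Sum>z\<in>T. u z * of_bool (z \<notin> B))"
    using pt u(1) by (intro sum_mono mult_left_mono) auto
  also have "\<dots> = sum u (T - B)"
    using \<open>finite T\<close> by (intro sum.mono_neutral_cong_right) auto
  also have "\<dots> = 1 - sum u B"
    using \<open>finite T\<close> u by (subst sum_diff) (auto simp: B_def)
  finally show ?thesis
    using q(2) by (simp add: B_def)
qed

lemma infnorm_le_iff_cart:
  fixes x :: "real ^ 'n"
  shows "infnorm x \<le> c \<longleftrightarrow> (\<forall>i. \<bar>x $ i\<bar> \<le> c)"
proof
  show "\<forall>i. \<bar>x $ i\<bar> \<le> c" if "infnorm x \<le> c"
    using that by (auto intro: order_trans[OF component_le_infnorm_cart])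
  show "infnorm x \<le> c" if "\<forall>i. \<bar>x $ i\<bar> \<le> c"
    unfolding infnorm_cart using that by (intro cSup_least) auto
qed

lemma integrally_convex_round:
  fixes S :: "(real ^ 'n) set"
  assumes n: "CARD('n) \<ge> 2" and S: "integrally_convex S" and y: "y \<in> convex hull S"
  obtains z where "z \<in> S" "infnorm (y - z) \<le> 1 - 1 / real CARD('n)"
proof -
  let ?r = "1 - 1 / real CARD('n)"
  have "y \<in> convex hull (S \<inter> int_nbhd y)"
    using S y by (auto simp: integrally_convex_def)
  then obtain T u where T: "finite T" "T \<subseteq> S \<inter> int_nbhd y"
    and u: "\<And>z. z \<in> T \<Longrightarrow> 0 \<le> u z" "sum u T = 1" and yT: "(\<Sum>z\<in>T. u z *\<^sub>R z) = y"
    unfolding convex_hull_explicit by blast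
  define B where "B i = {z \<in> T. ?r < \<bar>y $ i - z $ i\<bar>}" for i
  have B: "sum u (B i) < 1 / real CARD('n)" for i
  proof -
    have "sum u {z \<in> T. ?r < \<bar>y $ i - z $ i\<bar>} < 1 - ?r"
    proof (rule weight_of_far_integers)
      show "(\<Sum>z\<in>T. u z * z $ i) = y $ i"
        using yT by auto
      \<comment> \<open>This is where dimension at least 2 enters: the threshold is 0 in dimension
        1.\<close>
      show "1/2 \<le> ?r"
        using n by (simp add: field_simps)
    qed (use T u in \<open>auto simp: int_nbhd_def int_lattice_def\<close>)
    then show ?thesis by (simp add: B_def)
  qed
  have "\<exists>z\<in>T. \<forall>i. z \<notin> B i"
  proof (rule ccontr)
    assume "\<not> ?thesis"
    then have "T = (\<Union>i. B i)" by (auto simp: B_def)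
    then have "1 = sum u (\<Union>i. B i)" using u by simp
    also have "\<dots> \<le> (\<Sum>i\<in>UNIV. sum u (B i))"
    proof -
      \<comment> \<open>Union bound: the disjoint union \<open>Sigma UNIV B\<close> projects onto
        the union by \<open>snd\<close>, and a point bad in several coordinates is counted once for
        each.\<close>
      have "sum u (\<Union>i. B i) \<le> (\<Sum>(i, z)\<in>Sigma UNIV B. u z)"
        using T u by (intro sum_le_included[where i = snd]) (auto simp: B_def)
      also have "\<dots> = (\<Sum>i\<in>UNIV. sum u (B i))"
        using T by (subst sum.Sigma) (auto simp: B_def)
      finally show ?thesis .
    qed
    also have "\<dots> < (\<Sum>i\<in>(UNIV :: 'n set). 1 / real CARD('n))"
      using B by (intro sum_strict_mono) auto
    finally show False by simp
  qed
  then obtain z where "z \<in> T" "\<And>i. z \<notin> B i" by blast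
  then show ?thesis
    using T that[of z] by (auto simp: infnorm_le_iff_cart B_def not_less)
qed

section \<open>Rounding a Minkowski sum\<close>

text \<open>The bound falls short of the integer \<open>min n m\<close> by
  \<open>min n m / n\<close>, which is positive and at most 1.\<close>

lemma floor_alpha:
  assumes "n \<ge> 1" "m \<ge> 1"
  shows "\<lfloor>alpha n m\<rfloor> = int (min n m) - 1"
proof -
  have "0 < real (min n m) / real n" "real (min n m) / real n \<le> 1"
    using assms by (auto simp: divide_le_eq)
  moreover have "alpha n m = real (min n m) - real (min n m) / real n"
    by (simp add: alpha_def algebra_simps)
  ultimately show ?thesis
    by (intro floor_unique) auto
qed

theorem theorem3p1:
  fixes S :: "nat \<Rightarrow> (real ^ 'n) set" and W :: "(real ^ 'n) set" and m :: nat
  assumes "CARD('n) \<ge> 2"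
    and "m \<ge> 1"
    and "\<And>i. i \<in> {1..m} \<Longrightarrow> integrally_convex (S i)"
    and "W = (\<Sum>i\<in>{1..m}. S i)"
  shows "(\<forall>x \<in> convex hull W. \<exists>z \<in> W. infnorm (x - z) \<le> alpha CARD('n) m)
       \<and> (\<forall>x \<in> convex hull W \<inter> int_lattice.
            \<exists>z \<in> W. infnorm (x - z) \<le> real_of_int \<lfloor>alpha CARD('n) m\<rfloor>)
       \<and> \<lfloor>alpha CARD('n) m\<rfloor> = int (min CARD('n) m) - 1"
proof -
  let ?r = "1 - 1 / real CARD('n)"
  have near: "\<exists>z\<in>W. infnorm (x - z) \<le> alpha CARD('n) m" if "x \<in> convex hull W" for x
  proof -
    obtain y where y: "\<And>i. i \<in> {1..m} \<Longrightarrow> y i \<in> convex hull (S i)" "x = (\<Sum>i\<in>{1..m}. y i)"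
      and card_y: "card {i \<in> {1..m}. y i \<notin> S i} \<le> CARD('n)"
      using shapley_folkman[of "{1..m}" x S] \<open>x \<in> convex hull W\<close> assms(4) by auto
    define J where "J = {i \<in> {1..m}. y i \<notin> S i}"
    \<comment> \<open>Summands already in \<open>S i\<close> are kept without error, so only the
      indices in \<open>J\<close> contribute to the total.\<close>
    have "\<exists>z. z \<in> S i \<and> infnorm (y i - z) \<le> (if i \<in> J then ?r else 0)" if "i \<in> {1..m}" for i
    proof (cases "i \<in> J")
      case True
      then show ?thesis
        using integrally_convex_round[OF assms(1) assms(3)[OF that] y(1)[OF that]] by auto
    next
      case False
      then show ?thesis
        using that by (intro exI[of _ "y i"]) (auto simp: J_def infnorm_0)
    qed
    then obtain z where z: "\<And>i. i \<in> {1..m} \<Longrightarrow> z i \<in> S i"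
      "\<And>i. i \<in> {1..m} \<Longrightarrow> infnorm (y i - z i) \<le> (if i \<in> J then ?r else 0)"
      by metis
    \<comment> \<open>This trivial bound by \<open>m\<close> joins the Shapley--Folkman bound by the
      dimension to give the minimum in \<open>alpha\<close>.\<close>
    have "card J \<le> card {1..m}"
      by (intro card_mono) (auto simp: J_def)
    then have card_J: "card J \<le> min CARD('n) m"
      using card_y by (simp add: J_def)
    have "\<bar>(x - (\<Sum>i\<in>{1..m}. z i)) $ k\<bar> \<le> alpha CARD('n) m" for k
    proof -
      have "\<bar>(x - (\<Sum>i\<in>{1..m}. z i)) $ k\<bar> \<le> (\<Sum>i\<in>{1..m}. \<bar>(y i - z i) $ k\<bar>)"
        unfolding y(2) sum_subtractf[symmetric] sum_component by (rule sum_abs)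
      also have "\<dots> \<le> (\<Sum>i\<in>{1..m}. if i \<in> J then ?r else 0)"
        using z(2) unfolding infnorm_le_iff_cart by (intro sum_mono) blast
      also have "\<dots> = sum (\<lambda>_. ?r) J"
        unfolding J_def by (subst sum.inter_filter) auto
      also have "\<dots> = ?r * card J"
        by simp
      also have "\<dots> \<le> alpha CARD('n) m"
        unfolding alpha_def using card_J assms(1) by (intro mult_left_mono) auto
      finally show ?thesis .
    qed
    moreover have "(\<Sum>i\<in>{1..m}. z i) \<in> W"
      unfolding assms(4) set_sum_alt[OF finite_atLeastAtMost] using z(1) by blast
    ultimately show ?thesis
      by (meson infnorm_le_iff_cart)
  qed
  have W_int: "z \<in> int_lattice" if "z \<in> W" for z
  proof -
    have "z \<in> {sum s {1..m} |s. \<forall>i\<in>{1..m}. s i \<in> S i}"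
      using that unfolding assms(4) set_sum_alt[OF finite_atLeastAtMost] .
    then obtain s where "z = sum s {1..m}" "\<forall>i\<in>{1..m}. s i \<in> S i"
      by (elim CollectE exE conjE) (rule that)
    moreover have "S i \<subseteq> int_lattice" if "i \<in> {1..m}" for i
      using assms(3)[OF that] by (simp add: integrally_convex_def)
    ultimately show ?thesis
      unfolding int_lattice_def by (auto simp: subset_iff intro!: Ints_sum)
  qed
  have "\<exists>z\<in>W. infnorm (x - z) \<le> real_of_int \<lfloor>alpha CARD('n) m\<rfloor>"
    if x: "x \<in> convex hull W" "x \<in> int_lattice" for x
  proof -
    obtain z where z: "z \<in> W" "infnorm (x - z) \<le> alpha CARD('n) m"
      using near x by blast
    \<comment> \<open>The point \<open>z\<close> from the real bound serves again: each coordinate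
      of \<open>x - z\<close> is an integer, so its absolute value is at most the floor of the
      bound.\<close>
    have "\<bar>(x - z) $ k\<bar> \<le> real_of_int \<lfloor>alpha CARD('n) m\<rfloor>" for k
    proof -
      have "\<bar>(x - z) $ k\<bar> \<in> \<int>"
        using x(2) W_int[OF z(1)] by (auto simp: int_lattice_def)
      then obtain l where "\<bar>(x - z) $ k\<bar> = of_int l"
        by (auto elim: Ints_cases)
      then show ?thesis
        using z(2)[unfolded infnorm_le_iff_cart, rule_format, of k] by (simp add: le_floor_iff)
    qed
    then show ?thesis
      using z(1) by (auto simp: infnorm_le_iff_cart)
  qed
  then show ?thesis
    using near floor_alpha[of "CARD('n)" m] assms(1,2) by auto
qed

end
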